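(* Assume the Axiom of Choice. Let $X$ and $Y$ be nonempty sets, let $D$ be a nonempty subset of $X^*$, and let $F\colon X^*\to Y$ be a function. The following assertions are equivalent. (i) $F\in\mathcal{P}_D$. (ii) There exist $H\in\mathcal{A}_D$ and a one-to-one function $f\colon\mathrm{ran}(H)\to Y$ such that $F=f\circ H$. (iii) There exist $H\in\mathcal{A}_D$ such that $H(D)\subseteq D$ and a one-to-one function $f\colon\mathrm{ran}(H)\to Y$ such that $F=f\circ H$. Moreover, when these assertions hold, for any $g\in Q_D(F)$ one can choose $H=g\circ F$ and $f=F|_{\mathrm{ran}(H)}$ in assertions (ii) and (iii).
   Context: For a nonempty set $X$, $X^*=\bigcup_{n\geqslant 0}X^n$ is the set of all finite strings (tuples) over $X$, including the empty string $\varepsilon$ ($X^0=\{\varepsilon\}$), endowed with concatenation, written by juxtaposition, with neutral element $\varepsilon$. $\mathrm{ran}(F)$ and $\mathrm{dom}(F)$ denote the range and domain of $F$; ranges are arbitrary sets (not assumed to be contained in $X^*$). For a nonempty $D\subseteq X^*$: $\mathcal{A}_D$ is the class of functions $F\colon X^*\to\mathrm{ran}(F)$ such that $F(D)\subseteq X^*$ and $F(\mathbf{x}\mathbf{y}\mathbf{z})=F(\mathbf{x}F(\mathbf{y})\mathbf{z})$ for all $\mathbf{x},\mathbf{y},\mathbf{z}\in X^*$ with $\mathbf{y}\in D$. $\mathcal{P}_D$ is the class of functions $F\colon X^*\to\mathrm{ran}(F)$ such that for all $\mathbf{x},\mathbf{y},\mathbf{y}',\mathbf{z}\in X^*$ with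 $\mathbf{y},\mathbf{y}'\in D$, $F(\mathbf{y})=F(\mathbf{y}')$ implies $F(\mathbf{x}\mathbf{y}\mathbf{z})=F(\mathbf{x}\mathbf{y}'\mathbf{z})$. Membership of a function $F\colon X^*\to Y$ in such a class is understood by regarding $F$ as a function onto its range (the codomain plays no role). A function $g$ is a quasi-inverse of a function $f$ if $f\circ g|_{\mathrm{ran}(f)}=\mathrm{id}_{\mathrm{ran}(f)}$ and $\mathrm{ran}(g|_{\mathrm{ran}(f)})=\mathrm{ran}(g)$ (so $\mathrm{ran}(g)\subseteq\mathrm{dom}(f)$). $Q(f)$ is the set of quasi-inverses of $f$, and for $D\subseteq\mathrm{dom}(f)$, $Q_D(f)=\{g\in Q(f)\mid (g\circ f)(D)\subseteq D\}$. *)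

theory Defs
  imports Main "HOL-Library.FuncSet"
begin

text \<open>
  Strings over a set X are the elements of \<open>lists X\<close>. A function with domain
  \<open>lists X\<close> is a HOL function of which only the values on \<open>lists X\<close> matter; its range is its
  image of \<open>lists X\<close>.
\<close>

definition class_P :: "'a set \<Rightarrow> 'a list set \<Rightarrow> ('a list \<Rightarrow> 'b) set" where
  "class_P X D = {F. \<forall>x\<in>lists X. \<forall>z\<in>lists X. \<forall>y\<in>D. \<forall>y'\<in>D.
     F y = F y' \<longrightarrow> F (x @ y @ z) = F (x @ y' @ z)}"

text \<open>
  A function in the next class sends D to strings, but its other values are arbitrary objects,
  strings or not. The values are therefore taken in a sum type: \<open>Inl w\<close> with \<open>w \<in> lists X\<close> is
  the string w, and all other elements are non-strings, for an arbitrary type \<open>'c\<close>.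
  The first condition ensures that \<open>projl\<close> is applied only to strings in the second one.
\<close>

definition class_A :: "'a set \<Rightarrow> 'a list set \<Rightarrow> ('a list \<Rightarrow> 'a list + 'c) set" where
  "class_A X D = {F. F ` D \<subseteq> Inl ` lists X \<and>
     (\<forall>x\<in>lists X. \<forall>z\<in>lists X. \<forall>y\<in>D. F (x @ y @ z) = F (x @ projl (F y) @ z))}"

text \<open>
  Quasi-inverses of a function f with domain A. The domain of a quasi-inverse may be larger
  than the range of f, so it is recorded: the pair \<open>(G, g)\<close> is the function g with domain G.
  The first two conditions say that \<open>f \<circ> g\<close> is defined on the range of f.
\<close>

definition quasi_inverses :: "'a set \<Rightarrow> ('a \<Rightarrow> 'b) \<Rightarrow> ('b set \<times> ('b \<Rightarrow> 'a)) set" where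
  "quasi_inverses A f = {(G, g). f ` A \<subseteq> G \<and> g ` (f ` A) \<subseteq> A \<and>
     (\<forall>y\<in>f ` A. f (g y) = y) \<and> g ` (f ` A) = g ` G}"

definition quasi_inverses_on ::
    "'a set \<Rightarrow> 'a set \<Rightarrow> ('a \<Rightarrow> 'b) \<Rightarrow> ('b set \<times> ('b \<Rightarrow> 'a)) set" where
  "quasi_inverses_on D A f = {(G, g) \<in> quasi_inverses A f. (g \<circ> f) ` D \<subseteq> D}"

end

theory Submission
  imports Defs
begin

text \<open>Membership in \<open>class_P\<close> says that, for y in D, the value F(xyz) depends on
  y only through F(y). If H is in \<open>class_A\<close>, then H(xyz) = H(x H(y) z) has this
  property, and composing with an injection preserves it
  (\<open>class_P_if_inj_comp_class_A\<close>). Conversely, a quasi-inverse g of F that returns D to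
  itself turns each value F(y) with y in D into a string of D that has the same value under F. The
  class condition then lets g(F(y)) replace y, so H = g o F lies in \<open>class_A\<close>, and
  F(g(F(w))) = F(w) recovers F from H (\<open>quasi_inverse_factorization\<close>). The axiom of
  choice supplies such a g (\<open>quasi_inverses_on_nonempty\<close>).\<close>

lemma quasi_inverses_on_nonempty:
  assumes "D \<subseteq> A"
  shows "\<exists>g. (f ` A, g) \<in> quasi_inverses_on D A f"
proof -
  \<comment> \<open>Choose a preimage in D whenever there is one. This keeps g(f(D)) inside D, and
    since D is a subset of A, both branches select preimages in A.\<close>
  define g where "g = (\<lambda>b. if b \<in> f ` D then inv_into D f b else inv_into A f b)"
  have "g b \<in> A" "f (g b) = b" if "b \<in> f ` A" for b
    using that assms inv_into_into[of b f] f_inv_into_f[of b f] by (auto simp: g_def)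
  moreover have "g (f y) \<in> D" if "y \<in> D" for y
    using that by (auto simp: g_def intro: inv_into_into)
  ultimately have "(f ` A, g) \<in> quasi_inverses_on D A f"
    unfolding quasi_inverses_on_def quasi_inverses_def by auto
  then show ?thesis
    by (rule exI[of _ g])
qed

text \<open>Injectivity of \<open>f\<close> pulls the equality F(y) = F(y') back to H(y) = H(y'),
  where the defining identity of \<open>class_A\<close> applies.\<close>

lemma class_P_if_inj_comp_class_A:
  assumes D: "D \<subseteq> lists X"
    and H: "H \<in> class_A X D"
    and inj: "inj_on f (H ` lists X)"
    and F: "\<forall>w\<in>lists X. F w = f (H w)"
  shows "F \<in> class_P X D"
  unfolding class_P_def
proof (intro CollectI ballI impI)
  fix x z y y'
  assume x: "x \<in> lists X" and z: "z \<in> lists X" and y: "y \<in> D" "y' \<in> D" and "F y = F y'"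
  moreover have "y \<in> lists X" "y' \<in> lists X"
    using y D by blast+
  ultimately have "H y = H y'"
    using F by (intro inj_onD[OF inj]) simp_all
  \<comment> \<open>The right-hand side sees u only through \<open>H u\<close>; taking y and y' for
    u makes the two sides agree.\<close>
  moreover have "H (x @ u @ z) = H (x @ projl (H u) @ z)" if "u \<in> D" for u
    using H x z that unfolding class_A_def by blast
  ultimately have "H (x @ y @ z) = H (x @ y' @ z)"
    using y by metis
  moreover have "x @ y @ z \<in> lists X" "x @ y' @ z \<in> lists X"
    using x z y D by auto
  ultimately show "F (x @ y @ z) = F (x @ y' @ z)"
    using F by simp
qed

text \<open>Replacing y by g(F(y)) is a substitution inside D that preserves the value of F, which
  is exactly what \<open>class_P\<close> permits. All values of \<open>H\<close> are strings tagged
  by \<open>Inl\<close>, so on them \<open>f\<close> is the restriction of F to the range of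
  \<open>H\<close>.\<close>

lemma quasi_inverse_factorization:
  fixes X :: "'a set" and F :: "'a list \<Rightarrow> 'b"
  assumes D: "D \<subseteq> lists X"
    and Y: "F \<in> lists X \<rightarrow> Y"
    and P: "F \<in> class_P X D"
    and g: "(G, g) \<in> quasi_inverses_on D (lists X) F"
  defines "H \<equiv> \<lambda>w. Inl (g (F w)) :: 'a list + 'c"
    and "f \<equiv> \<lambda>v :: 'a list + 'c. F (projl v)"
  shows "H \<in> class_A X D \<and> H ` D \<subseteq> Inl ` D \<and>
    f \<in> H ` lists X \<rightarrow> Y \<and> inj_on f (H ` lists X) \<and>
    (\<forall>w\<in>lists X. F w = f (H w))"
proof -
  have Fg: "F (g (F w)) = F w" if "w \<in> lists X" for w
    using g that unfolding quasi_inverses_on_def quasi_inverses_def by auto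
  have gD: "g (F y) \<in> D" if "y \<in> D" for y
    using g that unfolding quasi_inverses_on_def by auto
  have "F (x @ y @ z) = F (x @ g (F y) @ z)"
    if "x \<in> lists X" "z \<in> lists X" "y \<in> D" for x y z
  proof -
    \<comment> \<open>So y and g(F(y)) are the two elements of D to which the condition of
      \<open>class_P\<close> is applied.\<close>
    have "F y = F (g (F y))"
      using Fg that(3) D by (metis subsetD)
    then show ?thesis
      using P that gD[OF that(3)] unfolding class_P_def by blast
  qed
  \<comment> \<open>Applying g and \<open>Inl\<close> to both sides gives the identity for
    \<open>H\<close>, because \<open>projl (H y)\<close> is g(F(y)).\<close>
  then have "H \<in> class_A X D"
    using gD D unfolding class_A_def H_def by fastforce
  moreover have "H ` D \<subseteq> Inl ` D"
    using gD unfolding H_def by auto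
  moreover have fH: "f (H w) = F w" if "w \<in> lists X" for w
    using Fg[OF that] unfolding f_def H_def by simp
  moreover have "f \<in> H ` lists X \<rightarrow> Y"
    by (rule Pi_I, erule imageE) (simp only: fH funcset_mem[OF Y])
  moreover have "inj_on f (H ` lists X)"
  \<comment> \<open>\<open>H\<close> factors through F: equal values of \<open>f\<close> at H(a) and
    H(b) mean F(a) = F(b), hence H(a) = H(b).\<close>
  proof (rule inj_onI)
    fix u v
    assume "u \<in> H ` lists X" "v \<in> H ` lists X" "f u = f v"
    then obtain a b where "u = H a" "v = H b" "F a = F b"
      by (elim imageE) (simp only: fH)
    then show "u = v"
      by (simp add: H_def)
  qed
  ultimately show ?thesis
    by simp
qed

theorem theorem3p7:
  fixes X :: "'a set" and Y :: "'b set" and D :: "'a list set" and F :: "'a list \<Rightarrow> 'b"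
  assumes "X \<noteq> {}" and "Y \<noteq> {}"
    and "D \<noteq> {}" and "D \<subseteq> lists X"
    and "F \<in> lists X \<rightarrow> Y"
  shows
    "(F \<in> class_P X D \<longleftrightarrow>
       (\<exists>(H :: 'a list \<Rightarrow> 'a list + 'c) f.
          H \<in> class_A X D \<and>
          f \<in> H ` lists X \<rightarrow> Y \<and> inj_on f (H ` lists X) \<and>
          (\<forall>w\<in>lists X. F w = f (H w))))
     \<and>
     (F \<in> class_P X D \<longleftrightarrow>
       (\<exists>(H :: 'a list \<Rightarrow> 'a list + 'c) f.
          H \<in> class_A X D \<and> H ` D \<subseteq> Inl ` D \<and>
          f \<in> H ` lists X \<rightarrow> Y \<and> inj_on f (H ` lists X) \<and>
          (\<forall>w\<in>lists X. F w = f (H w))))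
     \<and>
     (F \<in> class_P X D \<longrightarrow>
       (\<forall>G g. (G, g) \<in> quasi_inverses_on D (lists X) F \<longrightarrow>
          (let H = (\<lambda>w. Inl (g (F w)) :: 'a list + 'c);
               f = (\<lambda>v. F (projl v))
           in
             H \<in> class_A X D \<and> H ` D \<subseteq> Inl ` D \<and>
             f \<in> H ` lists X \<rightarrow> Y \<and> inj_on f (H ` lists X) \<and>
             (\<forall>w\<in>lists X. F w = f (H w)))))"
proof -
  note D = \<open>D \<subseteq> lists X\<close> and Y = \<open>F \<in> lists X \<rightarrow> Y\<close>
  obtain g where g: "(F ` lists X, g) \<in> quasi_inverses_on D (lists X) F"
    using quasi_inverses_on_nonempty[OF D] by blast
  note factorization = quasi_inverse_factorization[OF D Y, where 'c = 'c]
  have P_imp_iii: "\<exists>(H :: 'a list \<Rightarrow> 'a list + 'c) f.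
      H \<in> class_A X D \<and> H ` D \<subseteq> Inl ` D \<and>
      f \<in> H ` lists X \<rightarrow> Y \<and> inj_on f (H ` lists X) \<and> (\<forall>w\<in>lists X. F w = f (H w))"
    if "F \<in> class_P X D"
    by (rule exI[of _ "\<lambda>w. Inl (g (F w))"], rule exI[of _ "\<lambda>v. F (projl v)"])
      (rule factorization[OF that g])
  \<comment> \<open>This serves the converse of both equivalences, as (iii) only adds a condition on
    \<open>H\<close> to (ii).\<close>
  have ii_imp_P: "F \<in> class_P X D"
    if "H \<in> class_A X D" "inj_on f (H ` lists X)" "\<forall>w\<in>lists X. F w = f (H w)"
    for H :: "'a list \<Rightarrow> 'a list + 'c" and f
    using class_P_if_inj_comp_class_A[OF D that] .
  show ?thesis
    unfolding Let_def
  proof (intro conjI iffI)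
    assume P: "F \<in> class_P X D"
    \<comment> \<open>A factorization as in (iii) is in particular one as in (ii).\<close>
    obtain H :: "'a list \<Rightarrow> 'a list + 'c" and f
      where "H \<in> class_A X D" "f \<in> H ` lists X \<rightarrow> Y" "inj_on f (H ` lists X)"
        "\<forall>w\<in>lists X. F w = f (H w)"
      using P_imp_iii[OF P] by (elim exE conjE) (rule that)
    then show "\<exists>(H :: 'a list \<Rightarrow> 'a list + 'c) f. H \<in> class_A X D \<and>
        f \<in> H ` lists X \<rightarrow> Y \<and> inj_on f (H ` lists X) \<and> (\<forall>w\<in>lists X. F w = f (H w))"
      by (intro exI[of _ H] exI[of _ f] conjI)
  next
    assume "\<exists>(H :: 'a list \<Rightarrow> 'a list + 'c) f. H \<in> class_A X D \<and>
        f \<in> H ` lists X \<rightarrow> Y \<and> inj_on f (H ` lists X) \<and> (\<forall>w\<in>lists X. F w = f (H w))"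
    then show "F \<in> class_P X D"
      by (elim exE conjE) (rule ii_imp_P)
  next
    assume "\<exists>(H :: 'a list \<Rightarrow> 'a list + 'c) f. H \<in> class_A X D \<and> H ` D \<subseteq> Inl ` D \<and>
        f \<in> H ` lists X \<rightarrow> Y \<and> inj_on f (H ` lists X) \<and> (\<forall>w\<in>lists X. F w = f (H w))"
    then show "F \<in> class_P X D"
      by (elim exE conjE) (rule ii_imp_P)
  next
    show "F \<in> class_P X D \<longrightarrow> (\<forall>G g. (G, g) \<in> quasi_inverses_on D (lists X) F \<longrightarrow>
        (\<lambda>w. Inl (g (F w)) :: 'a list + 'c) \<in> class_A X D \<and>
        (\<lambda>w. Inl (g (F w)) :: 'a list + 'c) ` D \<subseteq> Inl ` D \<and>
        (\<lambda>v. F (projl v)) \<in> (\<lambda>w. Inl (g (F w)) :: 'a list + 'c) ` lists X \<rightarrow> Y \<and>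
        inj_on (\<lambda>v. F (projl v)) ((\<lambda>w. Inl (g (F w)) :: 'a list + 'c) ` lists X) \<and>
        (\<forall>w\<in>lists X. F w = F (projl (Inl (g (F w)) :: 'a list + 'c))))"
      (is "_ \<longrightarrow> (\<forall>G g. _ G g \<longrightarrow> ?factors g)")
    proof (intro impI allI)
      fix G g
      assume "F \<in> class_P X D" and "(G, g) \<in> quasi_inverses_on D (lists X) F"
      from factorization[OF this] show "?factors g" .
    qed
  qed (rule P_imp_iii)
qed

end
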